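(* Let $T$ be a rooted tree. For any multiset $S$ of vertices of $T$, $$\mathbf{x}_{f_S}=\sigma\left(\mathbf{x}_h\,\tau\left(\prod_{g\in S}\sigma^{h_S(g)}(\mathbf{x}_h|_g)\right)\right).$$
   Context: $T$ is a finite rooted tree with root $v_T$; $h_v$ is the coheight of $v$ (length of the path from $v_T$ to $v$); $S_v$ is the subtree consisting of $v$ and its descendants. Indeterminates $x_i$ are indexed by $i\in\mathbb{N}$. The coheight profile is $\mathbf{x}_h=\prod_{v\in V(T)}x_{h_v}$ and the coheight profile of $v$ is $\mathbf{x}_h|_v=\prod_{u\in V(S_v)}x_{h_u}$ (coheights measured in $T$). For a multiset $S$ of vertices, $f_S(v)=1+h_v+\sum_{g\in S}\mathbb{1}_{V(S_g)}(v)$ (with multiplicity) and $\mathbf{x}_{f_S}=\prod_{v}x_{f_S(v)}$. The shift $\sigma$ sends $k\prod_i x_i^{e_i}$ to $k\prod_i x_{i+1}^{e_i}$ (extended multiplicatively to Laurent monomials), $\sigma^s$ is its $s$-fold iterate, and $\tau(\mathbf{x})=\sigma(\mathbf{x})/\mathbf{x}$ for Laurent monomials $\mathbf{x}$. The elevation function $h_S$ assigns to each occurrence of an element $g$ in $S$ the number of elements of $S$ (with multiplicity) that are ancestors of $g$ or equal to $g$, not counting that occurrence itself; when a vertex occurs several times in $S$, its copies are ordered arbitrarily and receive consecutive values (e.g. if the root occurs three times, the copies get $0,1,2$). The product over $g\in S$ runs over all occurrences. *)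

theory Defs
  imports "Graph_Theory.Arc_Walk" "HOL-Library.Poly_Mapping" "HOL-Library.Multiset"
    "HOL-Library.Indicator_Function"
begin

section \<open>Rooted trees\<close>

text \<open>
  A tree is a finite simple undirected graph in which any two vertices are joined by exactly
  one path. Undirected graphs are the symmetric loop-free digraphs without parallel arcs
  (locale \<^locale>\<open>graph\<close>): an edge is a pair of opposite arcs. The notion of tree in
  \<open>Graph_Theory.Digraph_Component\<close> only excludes directed cycles; it is not used, because a pair
  of opposite arcs counts as a cycle there.
\<close>

locale rooted_tree = graph T for T :: "('a, 'b) pre_digraph" +
  fixes r :: 'a
  assumes root_in_verts: "r \<in> verts T"
    and unique_apath: "\<And>u v. u \<in> verts T \<Longrightarrow> v \<in> verts T \<Longrightarrow> \<exists>!p. apath u p v"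

definition root_path :: "('a, 'b) pre_digraph \<Rightarrow> 'a \<Rightarrow> 'a \<Rightarrow> 'b list" where
  "root_path T r v = (THE p. pre_digraph.apath T r p v)"

definition coheight :: "('a, 'b) pre_digraph \<Rightarrow> 'a \<Rightarrow> 'a \<Rightarrow> nat" where
  "coheight T r v = length (root_path T r v)"

text \<open>The vertex set of \<open>S\<^sub>v\<close>; the vertex \<open>v\<close> itself is included.\<close>

definition subtree_verts :: "('a, 'b) pre_digraph \<Rightarrow> 'a \<Rightarrow> 'a \<Rightarrow> 'a set" where
  "subtree_verts T r v =
     {u \<in> verts T. v \<in> set (pre_digraph.awalk_verts T r (root_path T r u))}"

definition proper_ancestor :: "('a, 'b) pre_digraph \<Rightarrow> 'a \<Rightarrow> 'a \<Rightarrow> 'a \<Rightarrow> bool" where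
  "proper_ancestor T r a v \<longleftrightarrow> a \<noteq> v \<and> v \<in> subtree_verts T r a"

section \<open>Laurent monomials\<close>

text \<open>
  Laurent polynomials in the indeterminates \<open>x\<^sub>i\<close> (\<open>i \<in> \<nat>\<close>) over \<open>'k\<close>: finitely
  supported functions from exponent vectors to coefficients, with the convolution product. The
  Laurent monomial with coefficient \<open>k\<close> and exponent vector \<open>e\<close> is
  \<open>Poly_Mapping.single e k\<close>.
\<close>

type_synonym 'k laurent = "(nat \<Rightarrow>\<^sub>0 int) \<Rightarrow>\<^sub>0 'k"

definition indet :: "nat \<Rightarrow> 'k::idom laurent" where
  "indet i = Poly_Mapping.single (Poly_Mapping.single i 1) 1"

definition shift_expo :: "(nat \<Rightarrow>\<^sub>0 int) \<Rightarrow> (nat \<Rightarrow>\<^sub>0 int)" where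
  "shift_expo e =
     (\<Sum>i\<in>Poly_Mapping.keys e. Poly_Mapping.single (Suc i) (Poly_Mapping.lookup e i))"

text \<open>The shift \<open>\<sigma>\<close> of monomials, extended linearly to Laurent polynomials.\<close>

definition shift :: "'k::idom laurent \<Rightarrow> 'k laurent" where
  "shift p =
     (\<Sum>e\<in>Poly_Mapping.keys p. Poly_Mapping.single (shift_expo e) (Poly_Mapping.lookup p e))"

text \<open>
  The quotient \<open>\<sigma>(m) / m\<close> in the ring of Laurent polynomials. It exists and is unique for every
  nonzero Laurent monomial \<open>m\<close> (lemma \<open>tau_single\<close>).
\<close>

definition tau :: "'k::idom laurent \<Rightarrow> 'k laurent" where
  "tau m = (THE q. q * m = shift m)"

lemma shift_single: "shift (Poly_Mapping.single e k) = Poly_Mapping.single (shift_expo e) k"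
  by (simp add: shift_def)

lemma lookup_shift_expo_Suc [simp]:
  "Poly_Mapping.lookup (shift_expo e) (Suc i) = Poly_Mapping.lookup e i"
  by (simp add: shift_expo_def lookup_sum lookup_single when_def in_keys_iff)

lemma lookup_shift_expo_0 [simp]: "Poly_Mapping.lookup (shift_expo e) 0 = 0"
  by (simp add: shift_expo_def lookup_sum lookup_single when_def)

lemma tau_single:
  fixes k :: "'k::idom"
  assumes "k \<noteq> 0"
  shows "tau (Poly_Mapping.single e k) = Poly_Mapping.single (shift_expo e - e) 1"
  unfolding tau_def
proof (rule the_equality)
  show eq: "Poly_Mapping.single (shift_expo e - e) 1 * Poly_Mapping.single e k
      = shift (Poly_Mapping.single e k)"
    by (simp add: shift_single mult_single)
  fix q :: "'k laurent"
  assume "q * Poly_Mapping.single e k = shift (Poly_Mapping.single e k)"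
  moreover have "Poly_Mapping.single e k \<noteq> 0"
    using assms by (metis lookup_single_eq lookup_zero)
  ultimately show "q = Poly_Mapping.single (shift_expo e - e) 1"
    using eq by (metis mult_right_cancel)
qed

section \<open>Profiles\<close>

definition coheight_profile :: "('a, 'b) pre_digraph \<Rightarrow> 'a \<Rightarrow> 'k::idom laurent" where
  "coheight_profile T r = (\<Prod>v\<in>verts T. indet (coheight T r v))"

definition coheight_profile_at :: "('a, 'b) pre_digraph \<Rightarrow> 'a \<Rightarrow> 'a \<Rightarrow> 'k::idom laurent" where
  "coheight_profile_at T r v = (\<Prod>u\<in>subtree_verts T r v. indet (coheight T r u))"

definition f_label :: "('a, 'b) pre_digraph \<Rightarrow> 'a \<Rightarrow> 'a multiset \<Rightarrow> 'a \<Rightarrow> nat" where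
  "f_label T r S v = 1 + coheight T r v + (\<Sum>g\<in>#S. indicator (subtree_verts T r g) v)"

definition f_profile :: "('a, 'b) pre_digraph \<Rightarrow> 'a \<Rightarrow> 'a multiset \<Rightarrow> 'k::idom laurent" where
  "f_profile T r S = (\<Prod>v\<in>verts T. indet (f_label T r S v))"

section \<open>Elevation\<close>

text \<open>The copies of \<open>g\<close> in \<open>S\<close> are the pairs \<open>(g, i)\<close> with \<open>i < count S g\<close>.\<close>

definition occurrences :: "'a multiset \<Rightarrow> ('a \<times> nat) set" where
  "occurrences S = {(g, i). i < count S g}"

text \<open>
  The copies of \<open>g\<close>, in an arbitrary order, receive the \<open>count S g\<close> consecutive values starting
  with the number (with multiplicity) of proper ancestors of \<open>g\<close> in \<open>S\<close>. The predicate
  characterises all functions obtained from some choice of these orders.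
\<close>

definition is_elevation ::
  "('a, 'b) pre_digraph \<Rightarrow> 'a \<Rightarrow> 'a multiset \<Rightarrow> ('a \<times> nat \<Rightarrow> nat) \<Rightarrow> bool" where
  "is_elevation T r S h \<longleftrightarrow>
     (\<forall>g\<in>#S. let n = size {#a \<in># S. proper_ancestor T r a g#} in
        bij_betw (\<lambda>i. h (g, i)) {..<count S g} {n..<n + count S g})"

lemma finite_occurrences: "finite (occurrences S)"
proof -
  have "occurrences S = Sigma (set_mset S) (\<lambda>g. {..<count S g})"
    by (auto simp: occurrences_def count_greater_zero_iff[symmetric] simp del: count_greater_zero_iff)
  then show ?thesis by simp
qed

lemma is_elevation_exists:
  "is_elevation T r S (\<lambda>(g, i). size {#a \<in># S. proper_ancestor T r a g#} + i)"
proof -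
  have "bij_betw (\<lambda>i. n + i) {..<c} {n..<n + c}" for n c :: nat
    by (rule bij_betwI[where g = "\<lambda>j. j - n"]) auto
  then show ?thesis by (simp add: is_elevation_def Let_def)
qed

end

theory Submission
  imports Defs
begin

text \<open>
  Every factor is a Laurent monomial with coefficient 1, so the identity is one between exponent
  vectors. Exchanging the product over occurrences with the product over vertices, the vertex \<open>u\<close>
  contributes \<open>x\<^sub>c\<close>, where \<open>c\<close> is its coheight, times the product of the quotients
  \<open>x\<^bsub>c + j + 1\<^esub> / x\<^bsub>c + j\<^esub>\<close> over the elevations \<open>j\<close> of the occurrences of
  ancestors of \<open>u\<close> in \<open>S\<close>. These ancestors form a chain, along which the elevations take each
  value \<open>0, \<dots>, N - 1\<close> exactly once; hence the product telescopes to
  \<open>x\<^bsub>c + N\<^esub> / x\<^sub>c\<close>, and \<open>c + N + 1\<close> is the label of \<open>u\<close>.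
\<close>

section \<open>Laurent monomials with coefficient one\<close>

lemma shift_expo_zero [simp]: "shift_expo 0 = 0"
  by (simp add: shift_expo_def)

lemma shift_expo_add: "shift_expo (a + b) = shift_expo a + shift_expo b"
proof (rule poly_mapping_eqI)
  fix k show "Poly_Mapping.lookup (shift_expo (a + b)) k
      = Poly_Mapping.lookup (shift_expo a + shift_expo b) k"
    by (cases k) (simp_all add: lookup_add)
qed

lemma shift_expo_sum: "shift_expo (sum f A) = (\<Sum>x\<in>A. shift_expo (f x))"
  by (induction A rule: infinite_finite_induct) (simp_all add: shift_expo_add)

lemma funpow_shift_expo_sum: "(shift_expo ^^ n) (sum f A) = (\<Sum>x\<in>A. (shift_expo ^^ n) (f x))"
  by (induction n) (simp_all add: shift_expo_sum)

lemma shift_expo_single: "shift_expo (Poly_Mapping.single i c) = Poly_Mapping.single (Suc i) c"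
  by (cases "c = 0") (simp_all add: shift_expo_def)

lemma funpow_shift_expo_single:
  "(shift_expo ^^ n) (Poly_Mapping.single i c) = Poly_Mapping.single (i + n) c"
  by (induction n) (simp_all add: shift_expo_single)

lemma funpow_shift_single:
  "(shift ^^ n) (Poly_Mapping.single e k) = Poly_Mapping.single ((shift_expo ^^ n) e) k"
  by (induction n) (simp_all add: shift_single)

lemma prod_single_one:
  "(\<Prod>x\<in>A. Poly_Mapping.single (f x) (1::'k::comm_semiring_1))
    = Poly_Mapping.single (\<Sum>x\<in>A. f x :: 'e::cancel_comm_monoid_add) 1"
  by (induction A rule: infinite_finite_induct) (simp_all add: mult_single)

section \<open>Elevations along a chain\<close>

lemma size_filter_mset_insert:
  assumes "v \<notin> A"
  shows "size {#a \<in># S. a \<in> insert v A#} = size {#a \<in># S. a \<in> A#} + count S v"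
  using assms by (induction S) auto

text \<open>The intervals tile an initial segment: each vertex of the chain starts exactly where the
  values used by the vertices before it end, so induction appends one interval at a time.\<close>

lemma bij_betw_occurrences_chain:
  assumes "distinct vs"
    and "\<And>us v ws. vs = us @ v # ws \<Longrightarrow>
      bij_betw (\<lambda>i. h (v, i)) {..<count S v}
        {size {#a \<in># S. a \<in> set us#}..<size {#a \<in># S. a \<in> set us#} + count S v}"
  shows "bij_betw h (Sigma (set vs) (\<lambda>g. {..<count S g})) {..<size {#a \<in># S. a \<in> set vs#}}"
  using assms
proof (induction vs rule: rev_induct)
  case Nil
  then show ?case by (simp add: bij_betw_def)
next
  case (snoc v vs)
  let ?n = "size {#a \<in># S. a \<in> set vs#}"
  have "bij_betw h (Sigma (set vs) (\<lambda>g. {..<count S g})) {..<?n}"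
    using snoc.prems by (intro snoc.IH) auto
  moreover have "bij_betw h ({v} \<times> {..<count S v}) {?n..<?n + count S v}"
  proof -
    \<comment> \<open>With \<open>v\<close> fixed, a copy is determined by its index, so the
      hypothesis on indices, taken for the split with nothing after \<open>v\<close>, carries over
      to pairs.\<close>
    have "bij_betw snd ({v} \<times> {..<count S v}) {..<count S v}"
      by (auto simp: bij_betw_def inj_on_def)
    from bij_betw_trans[OF this snoc.prems(2)[of vs v "[]"]] show ?thesis
      by (rule bij_betw_cong[THEN iffD1, rotated]) auto
  qed
  ultimately have "bij_betw h (Sigma (set vs) (\<lambda>g. {..<count S g}) \<union> {v} \<times> {..<count S v})
      ({..<?n} \<union> {?n..<?n + count S v})"
    by (rule bij_betw_combine) auto
  moreover have "Sigma (set vs) (\<lambda>g. {..<count S g}) \<union> {v} \<times> {..<count S v}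
      = Sigma (set (vs @ [v])) (\<lambda>g. {..<count S g})"
    by auto
  moreover have "{..<?n} \<union> {?n..<?n + count S v} = {..<size {#a \<in># S. a \<in> set (vs @ [v])#}}"
    using snoc.prems(1) size_filter_mset_insert[of v "set vs" S] by auto
  ultimately show ?case by simp
qed

section \<open>Root paths\<close>

context rooted_tree
begin

abbreviation root_verts :: "'a \<Rightarrow> 'a list" where
  "root_verts v \<equiv> awalk_verts r (root_path T r v)"

lemma apath_root_path:
  assumes "v \<in> verts T"
  shows "apath r (root_path T r v) v"
  unfolding root_path_def using unique_apath[OF root_in_verts assms] by (rule theI')

lemma root_path_eqI:
  assumes "apath r p v"
  shows "root_path T r v = p"
proof -
  have "v \<in> verts T"
    using assms by (auto simp: apath_def)
  then show ?thesis
    using unique_apath[OF root_in_verts] apath_root_path assms by blast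
qed

text \<open>An initial piece of a path from the root is again such a path, and uniqueness makes it
  the root path of its last vertex. This is what makes the ancestors of a vertex a chain.\<close>

lemma root_verts_prefix:
  assumes "u \<in> verts T" and "root_verts u = us @ v # ws"
  shows "root_verts v = us @ [v]" and "v \<in> verts T"
proof -
  have ap: "awalk r (root_path T r u) u" "distinct (root_verts u)"
    using apath_root_path[OF assms(1)] by (auto simp: apath_def)
  then have "cas r (root_path T r u) u"
    by auto
  from awalk_decomp_verts[OF this assms(2)] obtain p q
    where pq: "cas r p v" "root_path T r u = p @ q" "awalk_verts r p = us @ [v]" .
  have "awlast r p = v"
    using pq(3) by simp
  with ap(1) have "awalk r p v"
    unfolding pq(2) by simp
  moreover have "distinct (us @ [v])"
    using ap(2) assms(2) by simp
  ultimately have ap_p: "apath r p v"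
    using pq(3) by (simp add: apath_def)
  then have "root_path T r v = p"
    by (rule root_path_eqI)
  with pq(3) show "root_verts v = us @ [v]"
    by simp
  show "v \<in> verts T"
    using ap_p by (auto simp: apath_def)
qed

lemma bij_betw_elevation:
  assumes "is_elevation T r S h" and "u \<in> verts T"
  shows "bij_betw h {a \<in> occurrences S. u \<in> subtree_verts T r (fst a)}
    {..<size {#g \<in># S. u \<in> subtree_verts T r g#}}"
proof -
  have anc: "v \<in> subtree_verts T r g \<longleftrightarrow> g \<in> set (root_verts v)" if "v \<in> verts T" for v g
    using that by (simp add: subtree_verts_def)
  have dist: "distinct (root_verts u)"
    using apath_root_path[OF assms(2)] by (simp add: apath_def)
  have "bij_betw h (Sigma (set (root_verts u)) (\<lambda>g. {..<count S g}))
      {..<size {#g \<in># S. g \<in> set (root_verts u)#}}"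
  proof (rule bij_betw_occurrences_chain[OF dist])
    fix us v ws
    assume split: "root_verts u = us @ v # ws"
    note v = root_verts_prefix[OF assms(2) split]
    \<comment> \<open>The root path of \<open>v\<close> visits \<open>us @ [v]\<close>, and
      distinctness keeps \<open>v\<close> out of \<open>us\<close>.\<close>
    have "proper_ancestor T r a v \<longleftrightarrow> a \<in> set us" for a
      using dist split v by (auto simp: proper_ancestor_def anc)
    then show "bij_betw (\<lambda>i. h (v, i)) {..<count S v}
        {size {#a \<in># S. a \<in> set us#}..<size {#a \<in># S. a \<in> set us#} + count S v}"
      \<comment> \<open>\<open>is_elevation\<close> speaks only of vertices in \<open>S\<close>; for
        any other \<open>v\<close> the count is zero and both sides are empty.\<close>
      using assms(1) by (cases "v \<in># S") (auto simp: is_elevation_def Let_def not_in_iff bij_betw_def)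
  qed
  moreover have "Sigma (set (root_verts u)) (\<lambda>g. {..<count S g})
      = {a \<in> occurrences S. u \<in> subtree_verts T r (fst a)}"
    using assms(2) by (auto simp: occurrences_def anc)
  ultimately show ?thesis
    using assms(2) by (simp add: anc)
qed

end

lemma sum_mset_indicator: "(\<Sum>g\<in>#S. indicator (A g) v) = size {#g \<in># S. v \<in> A g#}"
  by (induction S) auto

theorem theorem4p11:
  fixes T :: "('a, 'b) pre_digraph" and r :: 'a and S :: "'a multiset"
    and h :: "'a \<times> nat \<Rightarrow> nat"
  assumes "rooted_tree T r"
    and "set_mset S \<subseteq> verts T"
    and "is_elevation T r S h"
  shows "(f_profile T r S :: 'k::idom laurent) =
    shift (coheight_profile T r *
      tau (\<Prod>(g, i)\<in>occurrences S. (shift ^^ h (g, i)) (coheight_profile_at T r g)))"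
proof -
  interpret rooted_tree T r by fact
  let ?O = "occurrences S" and ?V = "verts T" and ?c = "coheight T r" and ?D = "subtree_verts T r"
  define x :: "nat \<Rightarrow> nat \<Rightarrow>\<^sub>0 int" where "x i = Poly_Mapping.single i 1" for i
  define N where "N v = size {#g \<in># S. v \<in> ?D g#}" for v
  \<comment> \<open>\<open>m\<close> is the exponent vector of the product over all
    occurrences.\<close>
  define m where "m = (\<Sum>a\<in>?O. \<Sum>v\<in>?D (fst a). x (?c v + h a))"
  have indet_x: "indet i = (Poly_Mapping.single (x i) 1 :: 'k laurent)" for i
    by (simp add: indet_def x_def)
  have shift_x: "shift_expo (x i) = x (Suc i)" for i
    by (simp add: x_def shift_expo_single)
  have "(shift ^^ h a) (coheight_profile_at T r (fst a))
      = (Poly_Mapping.single (\<Sum>v\<in>?D (fst a). x (?c v + h a)) 1 :: 'k laurent)" for a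
    by (simp add: coheight_profile_at_def indet_x prod_single_one funpow_shift_single
        funpow_shift_expo_sum, simp add: x_def funpow_shift_expo_single)
  then have prod_eq: "(\<Prod>(g, i)\<in>?O. (shift ^^ h (g, i)) (coheight_profile_at T r g))
      = (Poly_Mapping.single m 1 :: 'k laurent)"
    by (simp add: case_prod_beta prod_single_one m_def)
  have m_swap: "m = (\<Sum>v\<in>?V. \<Sum>j<N v. x (?c v + j))"
  proof -
    \<comment> \<open>The inner range depends on \<open>a\<close>; writing it as a restriction of
      \<open>?V\<close> allows the two sums to be exchanged.\<close>
    have "m = (\<Sum>a\<in>?O. \<Sum>v | v \<in> ?V \<and> v \<in> ?D (fst a). x (?c v + h a))"
      unfolding m_def by (intro sum.cong refl) (auto simp: subtree_verts_def)
    also have "\<dots> = (\<Sum>v\<in>?V. \<Sum>a | a \<in> ?O \<and> v \<in> ?D (fst a). x (?c v + h a))"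
      by (rule sum.swap_restrict) (simp_all add: finite_occurrences)
    also have "\<dots> = (\<Sum>v\<in>?V. \<Sum>j<N v. x (?c v + j))"
    proof (rule sum.cong[OF refl])
      fix v assume "v \<in> ?V"
      from bij_betw_elevation[OF assms(3) this]
      show "(\<Sum>a | a \<in> ?O \<and> v \<in> ?D (fst a). x (?c v + h a)) = (\<Sum>j<N v. x (?c v + j))"
        unfolding N_def by (rule sum.reindex_bij_betw)
    qed
    finally show ?thesis .
  qed
  have "(\<Sum>v\<in>?V. x (?c v)) + (shift_expo m - m) = (\<Sum>v\<in>?V. x (?c v + N v))"
  proof -
    \<comment> \<open>Shifting raises each index by one, so consecutive terms cancel in the inner
      sum.\<close>
    have "shift_expo m - m = (\<Sum>v\<in>?V. \<Sum>j<N v. x (Suc (?c v + j)) - x (?c v + j))"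
      by (simp add: m_swap shift_expo_sum shift_x sum_subtractf)
    also have "\<dots> = (\<Sum>v\<in>?V. x (?c v + N v) - x (?c v))"
      using sum_lessThan_telescope[of "\<lambda>j. x (?c v + j)" for v] by simp
    finally show ?thesis by (simp add: sum_subtractf)
  qed
  \<comment> \<open>The summand \<open>1\<close> in \<open>f_label\<close> accounts for the
    outermost shift.\<close>
  moreover have "(f_profile T r S :: 'k laurent)
      = Poly_Mapping.single (shift_expo (\<Sum>v\<in>?V. x (?c v + N v))) 1"
    by (simp add: f_profile_def f_label_def sum_mset_indicator indet_x prod_single_one
        shift_expo_sum shift_x N_def)
  ultimately show ?thesis
    by (simp add: prod_eq tau_single coheight_profile_def indet_x prod_single_one mult_single
        shift_single)
qed

end
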